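(* Let $N \in \mathbb{R}^{n \times r}$, $V \in \mathbb{R}^{r \times n}$, and for $\kappa\in\mathbb{R}^r_+$ let $f_\kappa\colon\mathbb{R}^n_+\to\mathbb{R}^n$, $f_\kappa(x) = N_\kappa x^V$. Let $S = \mathrm{im}(N)$ and $s = \mathrm{rank}(N)$. The following are equivalent: (inj) for all $\kappa\in\mathbb{R}^r_+$ and all $x'\in\mathbb{R}^n_+$, $f_\kappa$ is injective on $(x'+S)\cap\mathbb{R}^n_+$; (jac) for all $\kappa \in \mathbb{R}^r_+$ and $x \in \mathbb{R}^n_+$, the Jacobian matrix $J_{f_\kappa}(x)$ is injective on $S$; (min) for all $I\subseteq [n]$, $J\subseteq [r]$ of cardinality $s$, the product $\det(N_{I,J}) \det(V_{J,I})$ either is zero or has the same sign as all other nonzero such products, and at least one such product is nonzero; (sig) $\sigma(\ker(N)) \cap \sigma(V(\Sigma(S^* ))) = \emptyset$.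
   Context: $\mathbb{R}_+$ denotes the strictly positive reals. $(x^V)_j=\prod_i x_i^{v_{ji}}$ (real exponents), $N_\kappa=N\,\mathrm{diag}(\kappa)$, $[n]=\{1,\dots,n\}$, $M_{K,L}$ is the submatrix with rows in $K$ and columns in $L$. $\sigma$ is the componentwise sign vector; for $T\subseteq\mathbb{R}^k$, $\sigma(T)=\{\sigma(x)\mid x\in T\}$ and $\Sigma(T)=\sigma^{-1}(\sigma(T))$; $S^*=S\setminus\{0\}$; $V(T)=\{Vx\mid x\in T\}$. *)

theory Defs
  imports "HOL-Analysis.Analysis" "HOL-Combinatorics.Permutations"
begin

text \<open>Strictly positive orthant.\<close>
definition pos_orthant :: "(real^'n) set" where
  "pos_orthant = {x. \<forall>i. x $ i > 0}"

text \<open>Generalized monomials: (x^V)_j = prod_i x_i powr v_ji, V an r x n matrix.\<close>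
definition monom_vec :: "real^'n^'r \<Rightarrow> real^'n \<Rightarrow> real^'r" where
  "monom_vec V x = (\<chi> j. \<Prod>i\<in>UNIV. (x $ i) powr (V $ j $ i))"

text \<open>f_kappa(x) = N diag(kappa) x^V.\<close>
definition f_kappa :: "real^'r^'n \<Rightarrow> real^'n^'r \<Rightarrow> real^'r \<Rightarrow> real^'n \<Rightarrow> real^'n" where
  "f_kappa N V \<kappa> x = N *v (\<chi> j. \<kappa> $ j * monom_vec V x $ j)"

text \<open>Componentwise sign vector and the sets sigma(T), Sigma(T).\<close>
definition sign_vec :: "real^'n \<Rightarrow> real^'n" where
  "sign_vec x = (\<chi> i. sgn (x $ i))"

definition Sigma_set :: "(real^'n) set \<Rightarrow> (real^'n) set" where
  "Sigma_set T = {y. sign_vec y \<in> sign_vec ` T}"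

text \<open>A fixed enumeration of a finite set by 0..<card A (the product of minors
  used below does not depend on this choice, since the same enumeration is
  used for rows and columns).\<close>
definition enum_set :: "'a set \<Rightarrow> nat \<Rightarrow> 'a" where
  "enum_set A = (SOME e. bij_betw e {..<card A} A)"

text \<open>Determinant (Leibniz formula) of the submatrix A_{I,J}, with |I| = |J|.\<close>
definition submat_det :: "real^'c^'r \<Rightarrow> 'r set \<Rightarrow> 'c set \<Rightarrow> real" where
  "submat_det A I J =
     (\<Sum>p | p permutes {..<card I}.
        of_int (sign p) * (\<Prod>i<card I. A $ enum_set I i $ enum_set J (p i)))"

end

theory Submission
  imports Defs "Jordan_Normal_Form.Determinant"
begin

text \<open>
  The Jacobian of \<open>f_kappa\<close> at \<open>x\<close> is \<open>N diag(\<kappa> x^V) V diag(1/x)\<close>, and as \<open>\<kappa>\<close> and \<open>x\<close>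
  range over the positive orthant the two diagonal factors range independently over all
  positive diagonal matrices. So (jac) says that \<open>N diag(c) V diag(e)\<close> is injective on \<open>S\<close>
  for all positive \<open>c\<close>, \<open>e\<close>. In the coordinates of a basis of \<open>S\<close> the determinant of this map
  is, by the Cauchy--Binet formula applied twice, the polynomial
  \<open>\<Sum>\<^sub>I\<^sub>,\<^sub>J det N\<^sub>I\<^sub>,\<^sub>J det V\<^sub>J\<^sub>,\<^sub>I c^J e^I\<close>. Letting the variables of one monomial tend to infinity
  makes that monomial dominate, so by connectedness of the orthant this polynomial has no zero
  there iff its nonzero coefficients share a sign and one exists, which is (min).
  The vectors with the sign pattern of \<open>a\<close> are exactly the positive rescalings of \<open>a\<close>, which
  turns the kernel condition into (sig). Finally, \<open>f_kappa x - f_kappa y = N diag(\<kappa>) (x^V - y^V)\<close>,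
  where \<open>x^V - y^V\<close> has the sign pattern of \<open>V (ln x - ln y)\<close> and \<open>ln x - ln y\<close> that of \<open>x - y\<close>;
  since every sign-compatible pair \<open>(z, u)\<close> is of the form \<open>(ln x - ln y, x - y)\<close>, (inj) is
  equivalent to (sig) as well.
\<close>

no_notation vec_index (infixl "$" 100)

section \<open>The positive orthant\<close>

lemma pos_orthantI: "(\<And>i. x $ i > 0) \<Longrightarrow> x \<in> pos_orthant"
  unfolding pos_orthant_def by auto

lemma pos_orthantD: "x \<in> pos_orthant \<Longrightarrow> x $ i > 0"
  unfolding pos_orthant_def by auto

lemma pos_orthant_mult: "c \<in> pos_orthant \<Longrightarrow> d \<in> pos_orthant \<Longrightarrow> c * d \<in> pos_orthant"
  by (simp add: pos_orthant_def)

lemma pos_orthant_inverse: "x \<in> pos_orthant \<Longrightarrow> (\<chi> i. 1 / x $ i) \<in> pos_orthant"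
  by (simp add: pos_orthant_def)

lemma pos_orthant_divide:
  assumes "c \<in> pos_orthant" "d \<in> pos_orthant"
  shows "(\<chi> i. c $ i / d $ i) \<in> pos_orthant" "(\<chi> i. c $ i / d $ i) * d = c"
  using assms by (auto simp: pos_orthant_def Finite_Cartesian_Product.vec_eq_iff less_imp_neq[symmetric])

lemma monom_vec_pos: "x \<in> pos_orthant \<Longrightarrow> monom_vec V x \<in> pos_orthant"
  unfolding monom_vec_def pos_orthant_def by (auto intro!: prod_pos simp: less_imp_neq[symmetric])

lemma convex_pos_orthant: "convex pos_orthant"
proof -
  have "0 < u * x + v * y" if "0 \<le> u" "0 \<le> v" "u + v = 1" "0 < x" "0 < y" for u v x y :: real
    using that by (cases "u = 0") (auto intro: add_pos_nonneg)
  then show ?thesis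
    unfolding convex_def pos_orthant_def by simp
qed

section \<open>Determinants of square arrays indexed by natural numbers\<close>

definition det_array :: "nat \<Rightarrow> (nat \<Rightarrow> nat \<Rightarrow> 'a::comm_ring_1) \<Rightarrow> 'a" where
  "det_array n M = (\<Sum>p | p permutes {..<n}. of_int (sign p) * (\<Prod>i<n. M i (p i)))"

lemma det_array_eq_det: "det_array n M = det (mat n n (\<lambda>(i,j). M i j))"
proof -
  have "det (mat n n (\<lambda>(i,j). M i j)) =
      (\<Sum>p | p permutes {..<n}. signof p * (\<Prod>i<n. mat n n (\<lambda>(i,j). M i j) $$ (i, p i)))"
    by (subst det_def') (auto simp: atLeast0LessThan)
  also have "\<dots> = det_array n M"
    unfolding det_array_def
  proof (rule sum.cong[OF refl])
    fix p assume "p \<in> {p. p permutes {..<n}}"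
    then have "(\<Prod>i<n. mat n n (\<lambda>(i,j). M i j) $$ (i, p i)) = (\<Prod>i<n. M i (p i))"
      using permutes_in_image[of p "{..<n}"] by (intro prod.cong) auto
    then show "signof p * (\<Prod>i<n. mat n n (\<lambda>(i,j). M i j) $$ (i, p i)) =
        of_int (sign p) * (\<Prod>i<n. M i (p i))"
      by simp
  qed
  finally show ?thesis ..
qed

lemma det_array_cong:
  assumes "\<And>i j. i < n \<Longrightarrow> j < n \<Longrightarrow> M i j = M' i j"
  shows "det_array n M = det_array n M'"
  unfolding det_array_def
proof (intro sum.cong refl arg_cong2[where f = "(*)"] prod.cong)
  fix p i assume "p \<in> {p. p permutes {..<n}}" "i \<in> {..<n}"
  then show "M i (p i) = M' i (p i)"
    using assms permutes_in_image[of p "{..<n}" i] by auto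
qed

lemma det_array_identical_rows:
  assumes "i < n" "j < n" "i \<noteq> j" "\<And>k. M i k = M j k"
  shows "det_array n M = 0"
  unfolding det_array_eq_det
  by (rule det_identical_rows[of _ n i j]) (use assms in \<open>auto simp: row_def\<close>)

lemma det_array_permute_rows:
  assumes p: "p permutes {..<n}"
  shows "det_array n (\<lambda>i j. M (p i) j) = of_int (sign p) * det_array n M"
proof -
  have "det_array n (\<lambda>i j. M (p i) j) = det (mat n n (\<lambda>(i,j). mat n n (\<lambda>(i,j). M i j) $$ (p i, j)))"
    unfolding det_array_eq_det
  proof (intro arg_cong[where f = det] eq_matI)
    fix i j assume "i < dim_row (mat n n (\<lambda>(i,j). mat n n (\<lambda>(i,j). M i j) $$ (p i, j)))"
      "j < dim_col (mat n n (\<lambda>(i,j). mat n n (\<lambda>(i,j). M i j) $$ (p i, j)))"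
    moreover from this have "p i < n" using permutes_in_image[OF p, of i] by simp
    ultimately show "mat n n (\<lambda>(i,j). M (p i) j) $$ (i, j) =
        mat n n (\<lambda>(i,j). mat n n (\<lambda>(i,j). M i j) $$ (p i, j)) $$ (i, j)"
      by simp
  qed auto
  also have "\<dots> = of_int (sign p) * det (mat n n (\<lambda>(i,j). M i j))"
    by (rule det_permute_rows) (use p in \<open>auto simp: atLeast0LessThan\<close>)
  finally show ?thesis by (simp add: det_array_eq_det)
qed

lemma det_array_mult:
  "det_array n (\<lambda>i j. \<Sum>k<n. A i k * B k j) = det_array n A * det_array n B"
proof -
  have "mat n n (\<lambda>(i,j). \<Sum>k<n. A i k * B k j) = mat n n (\<lambda>(i,j). A i j) * mat n n (\<lambda>(i,j). B i j)"
    by (rule eq_matI) (auto simp: scalar_prod_def atLeast0LessThan intro!: sum.cong)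
  then show ?thesis unfolding det_array_eq_det by (simp add: det_mult[of _ n])
qed

lemma det_array_scale_cols:
  "det_array n (\<lambda>i j. M i j * c j) = (\<Prod>j<n. c j) * det_array n M"
  unfolding det_array_def sum_distrib_left
proof (rule sum.cong[OF refl])
  fix p assume "p \<in> {p. p permutes {..<n}}"
  then have "(\<Prod>i<n. c (p i)) = (\<Prod>j<n. c j)"
    using prod.permute[of p "{..<n}" c] by (simp add: o_def)
  then show "of_int (sign p) * (\<Prod>i<n. M i (p i) * c (p i)) =
      (\<Prod>j<n. c j) * (of_int (sign p) * (\<Prod>i<n. M i (p i)))"
    by (simp add: prod.distrib)
qed

lemma mat_mult_vec_eq_0_iff:
  assumes "v \<in> carrier_vec n"
  shows "mat n n (\<lambda>(i,j). M i j) *\<^sub>v v = 0\<^sub>v n \<longleftrightarrow> (\<forall>k<n. (\<Sum>l<n. M k l * vec_index v l) = 0)"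
proof -
  have "mat n n (\<lambda>(i,j). M i j) *\<^sub>v v = vec n (\<lambda>k. \<Sum>l<n. M k l * vec_index v l)"
    using assms by (auto simp: scalar_prod_def atLeast0LessThan intro!: eq_vecI sum.cong)
  then show ?thesis by (auto simp: vec_eq_iff)
qed

lemma det_array_nonzero_iff:
  fixes M :: "nat \<Rightarrow> nat \<Rightarrow> 'a::field"
  shows "det_array n M \<noteq> 0 \<longleftrightarrow> (\<forall>w. (\<forall>k<n. (\<Sum>l<n. M k l * w l) = 0) \<longrightarrow> (\<forall>l<n. w l = 0))"
proof -
  have "det_array n M = 0 \<longleftrightarrow>
      (\<exists>v. v \<in> carrier_vec n \<and> v \<noteq> 0\<^sub>v n \<and> mat n n (\<lambda>(i,j). M i j) *\<^sub>v v = 0\<^sub>v n)"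
    unfolding det_array_eq_det by (rule det_0_iff_vec_prod_zero_field) simp
  also have "\<dots> \<longleftrightarrow> (\<exists>w. (\<forall>k<n. (\<Sum>l<n. M k l * w l) = 0) \<and> (\<exists>l<n. w l \<noteq> 0))"
  proof
    assume "\<exists>v. v \<in> carrier_vec n \<and> v \<noteq> 0\<^sub>v n \<and> mat n n (\<lambda>(i,j). M i j) *\<^sub>v v = 0\<^sub>v n"
    then obtain v where v: "v \<in> carrier_vec n" "v \<noteq> 0\<^sub>v n"
      and "\<forall>k<n. (\<Sum>l<n. M k l * vec_index v l) = 0"
      using mat_mult_vec_eq_0_iff by blast
    moreover have "\<exists>l<n. vec_index v l \<noteq> 0"
      using v by (auto simp: vec_eq_iff)
    ultimately show "\<exists>w. (\<forall>k<n. (\<Sum>l<n. M k l * w l) = 0) \<and> (\<exists>l<n. w l \<noteq> 0)"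
      by blast
  next
    assume "\<exists>w. (\<forall>k<n. (\<Sum>l<n. M k l * w l) = 0) \<and> (\<exists>l<n. w l \<noteq> 0)"
    then obtain w where w: "\<forall>k<n. (\<Sum>l<n. M k l * w l) = 0" "\<exists>l<n. w l \<noteq> 0"
      by blast
    have "(\<Sum>l<n. M k l * vec_index (vec n w) l) = (\<Sum>l<n. M k l * w l)" for k
      by (rule sum.cong) auto
    then have "mat n n (\<lambda>(i,j). M i j) *\<^sub>v vec n w = 0\<^sub>v n"
      using w(1) by (simp add: mat_mult_vec_eq_0_iff)
    moreover have "vec n w \<noteq> 0\<^sub>v n"
      using w(2) by (auto simp: vec_eq_iff)
    ultimately show "\<exists>v. v \<in> carrier_vec n \<and> v \<noteq> 0\<^sub>v n \<and> mat n n (\<lambda>(i,j). M i j) *\<^sub>v v = 0\<^sub>v n"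
      using vec_carrier by blast
  qed
  finally show ?thesis by blast
qed

lemma enum_set_bij:
  assumes "finite A"
  shows "bij_betw (enum_set A) {..<card A} A"
proof -
  obtain h where "bij_betw h {..<card A} A"
    using ex_bij_betw_nat_finite[OF assms] by (auto simp: atLeast0LessThan)
  then show ?thesis unfolding enum_set_def by (rule someI[where x = h])
qed

lemma submat_det_eq_det_array:
  "submat_det A I J = det_array (card I) (\<lambda>i j. A $ enum_set I i $ enum_set J j)"
  unfolding submat_det_def det_array_def by simp

lemma prod_enum_set:
  assumes "finite J"
  shows "(\<Prod>m<card J. f (enum_set J m)) = (\<Prod>j\<in>J. f j)"
  using prod.reindex_bij_betw[OF enum_set_bij[OF assms], of f] by simp

section \<open>The Cauchy--Binet formula\<close>

lemma enum_set_comp_bij: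
  assumes "finite J" "\<tau> permutes {..<card J}"
  shows "bij_betw (enum_set J \<circ> \<tau>) {..<card J} J"
  using bij_betw_trans[OF permutes_imp_bij[OF assms(2)] enum_set_bij[OF assms(1)]] .

lemma inv_enum_set_image_permutes:
  assumes "inj_on f {..<s}"
  shows "(\<lambda>i. if i < s then inv_into {..<s} (enum_set (f ` {..<s})) (f i) else i) permutes {..<s}"
proof -
  have "bij_betw (enum_set (f ` {..<s})) {..<s} (f ` {..<s})"
    using enum_set_bij[of "f ` {..<s}"] assms by (simp add: card_image)
  moreover have "bij_betw f {..<s} (f ` {..<s})"
    using assms by (simp add: bij_betw_def)
  ultimately have "bij_betw (inv_into {..<s} (enum_set (f ` {..<s})) \<circ> f) {..<s} {..<s}"
    using bij_betw_inv_into bij_betw_trans by blast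
  then have "bij_betw (\<lambda>i. if i < s then inv_into {..<s} (enum_set (f ` {..<s})) (f i) else i) {..<s} {..<s}"
    by (rule bij_betw_cong[THEN iffD1, rotated]) auto
  then show ?thesis
    by (rule bij_imp_permutes) auto
qed

lemma bij_betw_subsets_perms_inj_funs:
  fixes K :: "'a set"
  assumes K: "finite K"
  shows "bij_betw (\<lambda>(J, \<tau>). restrict (enum_set J \<circ> \<tau>) {..<s})
           (SIGMA J:{J. J \<subseteq> K \<and> card J = s}. {\<tau>. \<tau> permutes {..<s}})
           {f \<in> {..<s} \<rightarrow>\<^sub>E K. inj_on f {..<s}}"
proof -
  define \<phi> :: "'a set \<times> (nat \<Rightarrow> nat) \<Rightarrow> nat \<Rightarrow> 'a"
    where "\<phi> = (\<lambda>(J, \<tau>). restrict (enum_set J \<circ> \<tau>) {..<s})"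
  define \<psi> :: "(nat \<Rightarrow> 'a) \<Rightarrow> 'a set \<times> (nat \<Rightarrow> nat)"
    where "\<psi> = (\<lambda>f. (f ` {..<s},
      \<lambda>i. if i < s then inv_into {..<s} (enum_set (f ` {..<s})) (f i) else i))"
  have psi_phi: "\<psi> (\<phi> (J, \<tau>)) = (J, \<tau>)"
    and phi_mem: "\<phi> (J, \<tau>) \<in> {f \<in> {..<s} \<rightarrow>\<^sub>E K. inj_on f {..<s}}"
    if J: "J \<subseteq> K" "card J = s" and \<tau>: "\<tau> permutes {..<s}" for J \<tau>
  proof -
    have bij: "bij_betw (enum_set J \<circ> \<tau>) {..<s} J" "bij_betw (enum_set J) {..<s} J"
      using enum_set_comp_bij[of J \<tau>] enum_set_bij[of J] finite_subset[OF J(1) K] J(2) \<tau> by simp_all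
    then have "\<phi> (J, \<tau>) ` {..<s} = J"
      by (simp add: \<phi>_def bij_betw_def)
    moreover have "(\<lambda>i. if i < s then inv_into {..<s} (enum_set J) (enum_set J (\<tau> i)) else i) = \<tau>"
      using bij(2) permutes_in_image[OF \<tau>] permutes_not_in[OF \<tau>]
      by (auto simp: bij_betw_def inv_into_f_f)
    ultimately show "\<psi> (\<phi> (J, \<tau>)) = (J, \<tau>)"
      unfolding \<psi>_def by (simp add: \<phi>_def cong: if_cong)
    show "\<phi> (J, \<tau>) \<in> {f \<in> {..<s} \<rightarrow>\<^sub>E K. inj_on f {..<s}}"
      using bij(1) J(1) by (auto simp: \<phi>_def bij_betw_def inj_on_def)
  qed
  have phi_psi: "\<phi> (\<psi> f) = f"
    and psi_mem: "\<psi> f \<in> (SIGMA J:{J. J \<subseteq> K \<and> card J = s}. {\<tau>. \<tau> permutes {..<s}})"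
    if f: "f \<in> {..<s} \<rightarrow>\<^sub>E K" "inj_on f {..<s}" for f
  proof -
    have "enum_set (f ` {..<s}) ` {..<s} = f ` {..<s}"
      using enum_set_bij[of "f ` {..<s}"] f(2) by (simp add: bij_betw_def card_image)
    then show "\<phi> (\<psi> f) = f"
      using PiE_arb[OF f(1)] by (auto simp: \<phi>_def \<psi>_def f_inv_into_f)
    show "\<psi> f \<in> (SIGMA J:{J. J \<subseteq> K \<and> card J = s}. {\<tau>. \<tau> permutes {..<s}})"
      using f inv_enum_set_image_permutes[OF f(2)] by (auto simp: \<psi>_def card_image)
  qed
  have "bij_betw \<phi> (SIGMA J:{J. J \<subseteq> K \<and> card J = s}. {\<tau>. \<tau> permutes {..<s}})
           {f \<in> {..<s} \<rightarrow>\<^sub>E K. inj_on f {..<s}}"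
  proof (rule bij_betw_byWitness[where f' = \<psi>])
    show "\<forall>x\<in>SIGMA J:{J. J \<subseteq> K \<and> card J = s}. {\<tau>. \<tau> permutes {..<s}}. \<psi> (\<phi> x) = x"
      using psi_phi by blast
    show "\<phi> ` (SIGMA J:{J. J \<subseteq> K \<and> card J = s}. {\<tau>. \<tau> permutes {..<s}})
        \<subseteq> {f \<in> {..<s} \<rightarrow>\<^sub>E K. inj_on f {..<s}}"
      using phi_mem by blast
  qed (use phi_psi psi_mem in blast)+
  then show ?thesis by (simp add: \<phi>_def)
qed

lemma sum_inj_funs_eq_sum_subsets_perms:
  assumes K: "finite K"
  shows "(\<Sum>f | f \<in> {..<s} \<rightarrow>\<^sub>E K \<and> inj_on f {..<s}. g f) =
    (\<Sum>J | J \<subseteq> K \<and> card J = s. \<Sum>\<tau> | \<tau> permutes {..<s}. g (restrict (enum_set J \<circ> \<tau>) {..<s}))"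
proof -
  have "(\<Sum>f | f \<in> {..<s} \<rightarrow>\<^sub>E K \<and> inj_on f {..<s}. g f) =
      (\<Sum>x \<in> (SIGMA J:{J. J \<subseteq> K \<and> card J = s}. {\<tau>. \<tau> permutes {..<s}}).
        g ((\<lambda>(J, \<tau>). restrict (enum_set J \<circ> \<tau>) {..<s}) x))"
    by (rule sum.reindex_bij_betw[OF bij_betw_subsets_perms_inj_funs[OF K], symmetric])
  also have "\<dots> = (\<Sum>J | J \<subseteq> K \<and> card J = s. \<Sum>\<tau> | \<tau> permutes {..<s}. g (restrict (enum_set J \<circ> \<tau>) {..<s}))"
    by (subst sum.Sigma) (auto simp: split_def K finite_permutations)
  finally show ?thesis .
qed

lemma det_array_product_expansion:
  fixes A :: "nat \<Rightarrow> 'k \<Rightarrow> 'a::comm_ring_1"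
  assumes K: "finite K"
  shows "det_array s (\<lambda>i j. \<Sum>k\<in>K. A i k * B k j) =
    (\<Sum>f | f \<in> {..<s} \<rightarrow>\<^sub>E K \<and> inj_on f {..<s}. (\<Prod>i<s. A i (f i)) * det_array s (\<lambda>i j. B (f i) j))"
proof -
  let ?g = "\<lambda>f. (\<Prod>i<s. A i (f i)) * det_array s (\<lambda>i j. B (f i) j)"
  have "det_array s (\<lambda>i j. \<Sum>k\<in>K. A i k * B k j) =
      (\<Sum>p | p permutes {..<s}. \<Sum>f\<in>{..<s} \<rightarrow>\<^sub>E K. (\<Prod>i<s. A i (f i)) * (of_int (sign p) * (\<Prod>i<s. B (f i) (p i))))"
    unfolding det_array_def
    by (simp add: prod_sum_PiE K sum_distrib_left prod.distrib mult_ac)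
  also have "\<dots> = (\<Sum>f\<in>{..<s} \<rightarrow>\<^sub>E K. ?g f)"
    by (subst sum.swap) (simp add: det_array_def sum_distrib_left)
  also have "\<dots> = (\<Sum>f | f \<in> {..<s} \<rightarrow>\<^sub>E K \<and> inj_on f {..<s}. ?g f)"
  proof (rule sum.mono_neutral_right)
    show "\<forall>f\<in>({..<s} \<rightarrow>\<^sub>E K) - {f. f \<in> {..<s} \<rightarrow>\<^sub>E K \<and> inj_on f {..<s}}. ?g f = 0"
    proof
      fix f assume "f \<in> ({..<s} \<rightarrow>\<^sub>E K) - {f. f \<in> {..<s} \<rightarrow>\<^sub>E K \<and> inj_on f {..<s}}"
      then obtain i j where "i < s" "j < s" "i \<noteq> j" "f i = f j"
        by (auto simp: inj_on_def)
      then have "det_array s (\<lambda>i j. B (f i) j) = 0"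
        by (intro det_array_identical_rows[of i s j]) simp_all
      then show "?g f = 0" by simp
    qed
  qed (use K in \<open>auto simp: finite_PiE\<close>)
  finally show ?thesis .
qed

lemma cauchy_binet:
  fixes A :: "nat \<Rightarrow> 'k \<Rightarrow> 'a::comm_ring_1"
  assumes K: "finite K"
  shows "det_array s (\<lambda>i j. \<Sum>k\<in>K. A i k * B k j) =
    (\<Sum>J | J \<subseteq> K \<and> card J = s.
       det_array s (\<lambda>i j. A i (enum_set J j)) * det_array s (\<lambda>i j. B (enum_set J i) j))"
proof -
  have "(\<Prod>i<s. A i (restrict (enum_set J \<circ> \<tau>) {..<s} i)) * det_array s (\<lambda>i j. B (restrict (enum_set J \<circ> \<tau>) {..<s} i) j) =
      det_array s (\<lambda>i j. B (enum_set J i) j) * (of_int (sign \<tau>) * (\<Prod>i<s. A i (enum_set J (\<tau> i))))"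
    if \<tau>: "\<tau> permutes {..<s}" for J \<tau>
  proof -
    have "det_array s (\<lambda>i j. B (restrict (enum_set J \<circ> \<tau>) {..<s} i) j) =
        det_array s (\<lambda>i j. B (enum_set J (\<tau> i)) j)"
      by (rule det_array_cong) simp
    also have "\<dots> = of_int (sign \<tau>) * det_array s (\<lambda>i j. B (enum_set J i) j)"
      by (rule det_array_permute_rows[OF \<tau>])
    finally show ?thesis by simp
  qed
  then have "det_array s (\<lambda>i j. \<Sum>k\<in>K. A i k * B k j) =
      (\<Sum>J | J \<subseteq> K \<and> card J = s. \<Sum>\<tau> | \<tau> permutes {..<s}.
        det_array s (\<lambda>i j. B (enum_set J i) j) * (of_int (sign \<tau>) * (\<Prod>i<s. A i (enum_set J (\<tau> i)))))"
    unfolding det_array_product_expansion[OF K] sum_inj_funs_eq_sum_subsets_perms[OF K]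
    by (intro sum.cong refl) simp
  also have "\<dots> = (\<Sum>J | J \<subseteq> K \<and> card J = s.
      det_array s (\<lambda>i j. A i (enum_set J j)) * det_array s (\<lambda>i j. B (enum_set J i) j))"
  proof (intro sum.cong refl)
    fix J
    show "(\<Sum>\<tau> | \<tau> permutes {..<s}. det_array s (\<lambda>i j. B (enum_set J i) j) *
          (of_int (sign \<tau>) * (\<Prod>i<s. A i (enum_set J (\<tau> i))))) =
        det_array s (\<lambda>i j. A i (enum_set J j)) * det_array s (\<lambda>i j. B (enum_set J i) j)"
      unfolding det_array_def[of s "\<lambda>i j. A i (enum_set J j)"] sum_distrib_left sum_distrib_right
      by (simp add: mult.commute)
  qed
  finally show ?thesis .
qed

section \<open>Sign patterns of sums of square-free monomials\<close>

definition subset_poly :: "nat \<Rightarrow> ('n::finite set \<Rightarrow> 'r::finite set \<Rightarrow> real) \<Rightarrow> real^'r \<Rightarrow> real^'n \<Rightarrow> real"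
  where "subset_poly s a c e =
    (\<Sum>I | card I = s. \<Sum>J | card J = s. a I J * (\<Prod>j\<in>J. c $ j) * (\<Prod>i\<in>I. e $ i))"

definition sign_consistent :: "nat \<Rightarrow> ('n set \<Rightarrow> 'r set \<Rightarrow> real) \<Rightarrow> bool"
  where "sign_consistent s a \<longleftrightarrow>
    (\<forall>I J I' J'. card I = s \<and> card J = s \<and> card I' = s \<and> card J' = s \<and>
       a I J \<noteq> 0 \<and> a I' J' \<noteq> 0 \<longrightarrow> sgn (a I J) = sgn (a I' J'))
    \<and> (\<exists>I J. card I = s \<and> card J = s \<and> a I J \<noteq> 0)"

lemma power_ratio_tendsto_0:
  assumes "k < m"
  shows "((\<lambda>T::real. T ^ k / T ^ m) \<longlongrightarrow> 0) at_top"
proof -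
  have "filterlim (\<lambda>T::real. T ^ (m - k)) at_top at_top"
    using assms by (intro filterlim_pow_at_top filterlim_ident) auto
  then have "((\<lambda>T::real. inverse (T ^ (m - k))) \<longlongrightarrow> 0) at_top"
    by (rule tendsto_inverse_0_at_top)
  moreover have "\<forall>\<^sub>F T in at_top. inverse (T ^ (m - k)) = T ^ k / (T::real) ^ m"
    using eventually_gt_at_top[of "0::real"]
    by eventually_elim (use assms in \<open>simp add: power_diff field_simps\<close>)
  ultimately show ?thesis
    by (rule Lim_transform_eventually)
qed

lemma card_Int_add_card_Int_less:
  fixes I I1 :: "'a::finite set" and J J1 :: "'b::finite set"
  assumes "card I = s" "card J = s" "card I1 = s" "card J1 = s" "(I, J) \<noteq> (I1, J1)"
  shows "card (J \<inter> J1) + card (I \<inter> I1) < 2 * s"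
proof -
  have "card (J \<inter> J1) \<le> card J" "card (I \<inter> I1) \<le> card I"
    by (auto intro: card_mono)
  moreover have "card (J \<inter> J1) < card J \<or> card (I \<inter> I1) < card I"
    using assms by (metis Int_lower1 Int_lower2 card_subset_eq finite le_neq_implies_less card_mono)
  ultimately show ?thesis
    using assms by linarith
qed

text \<open>Along the ray that scales exactly the coordinates in \<open>J1\<close> and \<open>I1\<close> by \<open>T\<close>, the
  monomial of \<open>(I1, J1)\<close> is the only one of top degree \<open>2 s\<close>.\<close>

lemma subset_poly_along_ray:
  fixes a :: "'n::finite set \<Rightarrow> 'r::finite set \<Rightarrow> real"
  assumes I1: "card I1 = s" and J1: "card J1 = s"
  shows "((\<lambda>T. subset_poly s a (\<chi> j. if j \<in> J1 then T else 1) (\<chi> i. if i \<in> I1 then T else 1)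
      / T ^ (2 * s)) \<longlongrightarrow> a I1 J1) at_top"
proof -
  define d where "d = (\<lambda>I J. card (J \<inter> J1) + card (I \<inter> I1))"
  have "(\<Prod>j\<in>J. (\<chi> j. if j \<in> J1 then T else 1) $ j) * (\<Prod>i\<in>I. (\<chi> i. if i \<in> I1 then T else 1) $ i)
      = T ^ d I J" for T :: real and I J
    by (simp add: d_def prod.If_cases Int_def power_add)
  then have poly: "subset_poly s a (\<chi> j. if j \<in> J1 then T else 1) (\<chi> i. if i \<in> I1 then T else 1)
      / T ^ (2 * s) = (\<Sum>I | card I = s. \<Sum>J | card J = s. a I J * (T ^ d I J / T ^ (2 * s)))" for T
    unfolding subset_poly_def sum_divide_distrib by (simp add: mult.assoc)
  have d_less: "d I J < 2 * s" if "card I = s" "card J = s" "(I, J) \<noteq> (I1, J1)" for I J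
    unfolding d_def using that(1,2) I1 J1 that(3) by (rule card_Int_add_card_Int_less)
  have "((\<lambda>T. a I J * (T ^ d I J / T ^ (2 * s))) \<longlongrightarrow> (if (I, J) = (I1, J1) then a I1 J1 else 0)) at_top"
    if "card I = s" "card J = s" for I J
  proof (cases "(I, J) = (I1, J1)")
    case True
    have "\<forall>\<^sub>F T in at_top. a I1 J1 = a I J * (T ^ d I J / T ^ (2 * s))"
      using eventually_gt_at_top[of "0::real"] by eventually_elim (use True I1 J1 in \<open>simp add: d_def mult_2\<close>)
    then have "((\<lambda>T. a I J * (T ^ d I J / T ^ (2 * s))) \<longlongrightarrow> a I1 J1) at_top"
      by (rule Lim_transform_eventually[OF tendsto_const])
    then show ?thesis
      using True by simp
  next
    case False
    show ?thesis
      unfolding if_not_P[OF False]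
      using tendsto_mult_right_zero[OF power_ratio_tendsto_0[OF d_less[OF that False]]] by simp
  qed
  then have "((\<lambda>T. \<Sum>I | card I = s. \<Sum>J | card J = s. a I J * (T ^ d I J / T ^ (2 * s))) \<longlongrightarrow>
      (\<Sum>I | card I = s. \<Sum>J | card J = s. if (I, J) = (I1, J1) then a I1 J1 else 0)) at_top"
    by (intro tendsto_sum) auto
  also have "(\<Sum>I | card I = s. \<Sum>J | card J = s. if (I, J) = (I1, J1) then a I1 J1 else 0) = a I1 J1"
  proof -
    have "(\<Sum>I | card I = s. \<Sum>J | card J = s. if (I, J) = (I1, J1) then a I1 J1 else 0) =
        (\<Sum>I | card I = s. if I = I1 then a I1 J1 else 0)"
      by (intro sum.cong refl) (use J1 in \<open>auto simp: sum.delta'\<close>)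
    then show ?thesis
      using I1 by (simp add: sum.delta')
  qed
  finally show ?thesis
    unfolding poly .
qed

lemma subset_poly_attains_sign:
  fixes a :: "'n::finite set \<Rightarrow> 'r::finite set \<Rightarrow> real"
  assumes I1: "card I1 = s" and J1: "card J1 = s" and a: "a I1 J1 \<noteq> 0"
  shows "\<exists>c\<in>pos_orthant. \<exists>e\<in>pos_orthant. sgn (subset_poly s a c e) = sgn (a I1 J1)"
proof -
  let ?c = "\<lambda>T. (\<chi> j. if j \<in> J1 then T else 1) :: real^'r"
  let ?e = "\<lambda>T. (\<chi> i. if i \<in> I1 then T else 1) :: real^'n"
  define q where "q = (\<lambda>T. subset_poly s a (?c T) (?e T) / T ^ (2 * s))"
  have "\<forall>\<^sub>F T in at_top. sgn (q T) = sgn (a I1 J1)"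
  proof (cases "a I1 J1 > 0")
    case True
    have "\<forall>\<^sub>F T in at_top. 0 < q T"
      unfolding q_def using order_tendstoD(1)[OF subset_poly_along_ray[OF I1 J1, of a] True] .
    then show ?thesis
      by (rule eventually_mono) (simp add: True)
  next
    case False
    with a have neg: "a I1 J1 < 0" by simp
    have "\<forall>\<^sub>F T in at_top. q T < 0"
      unfolding q_def using order_tendstoD(2)[OF subset_poly_along_ray[OF I1 J1, of a] neg] .
    then show ?thesis
      by (rule eventually_mono) (simp add: neg)
  qed
  then have "\<forall>\<^sub>F T in at_top. sgn (q T) = sgn (a I1 J1) \<and> T > 0"
    using eventually_gt_at_top[of 0] by (rule eventually_conj)
  then obtain T0 where "\<forall>T\<ge>T0. sgn (q T) = sgn (a I1 J1) \<and> T > 0"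
    unfolding eventually_at_top_linorder by blast
  then obtain T where T: "sgn (q T) = sgn (a I1 J1)" "T > 0"
    by blast
  then have "sgn (subset_poly s a (?c T) (?e T)) = sgn (a I1 J1)"
    by (simp add: q_def sgn_divide)
  moreover have "?c T \<in> pos_orthant" "?e T \<in> pos_orthant"
    using T(2) by (auto intro: pos_orthantI)
  ultimately show ?thesis by blast
qed

lemma sign_consistent_subset_poly_sgn:
  fixes a :: "'n::finite set \<Rightarrow> 'r::finite set \<Rightarrow> real"
  assumes "sign_consistent s a" and I0: "card I0 = s" "card J0 = s" "a I0 J0 \<noteq> 0"
    and c: "c \<in> pos_orthant" and e: "e \<in> pos_orthant"
  shows "sgn (subset_poly s a c e) = sgn (a I0 J0)"
proof -
  let ?m = "\<lambda>I J. (\<Prod>j\<in>J. c $ j) * (\<Prod>i\<in>I. e $ i)"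
  have m: "0 < ?m I J" for I J
    using pos_orthantD[OF c] pos_orthantD[OF e] by (simp add: prod_pos)
  have abs: "sgn (a I0 J0) * a I J = \<bar>a I J\<bar>" if "card I = s" "card J = s" for I J
    using assms(1) I0 that unfolding sign_consistent_def by (metis abs_sgn mult.commute mult_zero_right)
  have "sgn (a I0 J0) * subset_poly s a c e = (\<Sum>I | card I = s. \<Sum>J | card J = s. \<bar>a I J\<bar> * ?m I J)"
    unfolding subset_poly_def sum_distrib_left
    by (intro sum.cong refl) (simp add: abs[symmetric] mult_ac)
  also have "\<dots> > 0"
  proof (rule sum_pos2[of _ I0])
    have "0 \<le> \<bar>a I J\<bar> * ?m I J" for I J
      using m[of J I] by simp
    moreover have "0 < \<bar>a I0 J0\<bar> * ?m I0 J0"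
      using m[of J0 I0] I0(3) by simp
    ultimately show "0 < (\<Sum>J | card J = s. \<bar>a I0 J\<bar> * ?m I0 J)"
      using I0 by (intro sum_pos2[of _ J0]) auto
    show "0 \<le> (\<Sum>J | card J = s. \<bar>a I J\<bar> * ?m I J)" for I
      using m by (intro sum_nonneg) (simp add: less_imp_le)
  qed (use I0 in auto)
  finally show ?thesis
    using I0(3) by (auto simp: sgn_if zero_less_mult_iff split: if_splits)
qed

lemma subset_poly_zero_between:
  fixes a :: "'n::finite set \<Rightarrow> 'r::finite set \<Rightarrow> real"
  assumes "c \<in> pos_orthant" "e \<in> pos_orthant" "c' \<in> pos_orthant" "e' \<in> pos_orthant"
    and "subset_poly s a c e * subset_poly s a c' e' < 0"
  shows "\<exists>c''\<in>pos_orthant. \<exists>e''\<in>pos_orthant. subset_poly s a c'' e'' = 0"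
proof -
  define P where "P = (\<lambda>x. subset_poly s a (fst x) (snd x))"
  let ?U = "P ` (pos_orthant \<times> pos_orthant)"
  have "continuous_on (pos_orthant \<times> pos_orthant) P"
    unfolding P_def subset_poly_def by (intro continuous_intros)
  then have "connected ?U"
    by (intro connected_continuous_image convex_connected convex_Times convex_pos_orthant)
  moreover have "P (c, e) \<in> ?U" "P (c', e') \<in> ?U"
    using assms(1-4) by auto
  moreover have "P (c, e) \<le> 0 \<and> 0 \<le> P (c', e') \<or> P (c', e') \<le> 0 \<and> 0 \<le> P (c, e)"
    using assms(5) by (auto simp: P_def mult_less_0_iff)
  ultimately have "0 \<in> ?U"
    unfolding connected_iff_interval by blast
  then show ?thesis
    unfolding P_def by fastforce
qed

lemma subset_poly_nonvanishing_iff: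
  fixes a :: "'n::finite set \<Rightarrow> 'r::finite set \<Rightarrow> real"
  shows "(\<forall>c\<in>pos_orthant. \<forall>e\<in>pos_orthant. subset_poly s a c e \<noteq> 0) \<longleftrightarrow> sign_consistent s a"
proof
  assume nz: "\<forall>c\<in>pos_orthant. \<forall>e\<in>pos_orthant. subset_poly s a c e \<noteq> 0"
  have "(\<chi> _. 1) \<in> (pos_orthant :: (real^'r) set)" "(\<chi> _. 1) \<in> (pos_orthant :: (real^'n) set)"
    by (auto intro: pos_orthantI)
  with nz have "subset_poly s a (\<chi> _. 1) (\<chi> _. 1) \<noteq> 0"
    by blast
  then have "\<exists>I J. card I = s \<and> card J = s \<and> a I J \<noteq> 0"
    unfolding subset_poly_def by (auto intro: sum.neutral)
  moreover have "sgn (a I J) = sgn (a I' J')"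
    if IJ: "card I = s" "card J = s" "card I' = s" "card J' = s" "a I J \<noteq> 0" "a I' J' \<noteq> 0"
    for I J I' J'
  proof (rule ccontr)
    assume "sgn (a I J) \<noteq> sgn (a I' J')"
    moreover obtain c e where ce: "c \<in> pos_orthant" "e \<in> pos_orthant"
      and "sgn (subset_poly s a c e) = sgn (a I J)"
      using subset_poly_attains_sign[of I s J a] IJ by blast
    moreover obtain c' e' where ce': "c' \<in> pos_orthant" "e' \<in> pos_orthant"
      and "sgn (subset_poly s a c' e') = sgn (a I' J')"
      using subset_poly_attains_sign[of I' s J' a] IJ by blast
    ultimately have "subset_poly s a c e * subset_poly s a c' e' < 0"
      using IJ(5,6) by (auto simp: sgn_if mult_less_0_iff split: if_splits)
    with nz show False
      using subset_poly_zero_between[OF ce ce'] by blast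
  qed
  ultimately show "sign_consistent s a"
    unfolding sign_consistent_def by blast
next
  assume "sign_consistent s a"
  then obtain I0 J0 where "card I0 = s" "card J0 = s" "a I0 J0 \<noteq> 0"
    unfolding sign_consistent_def by blast
  with sign_consistent_subset_poly_sgn[OF \<open>sign_consistent s a\<close> this]
  show "\<forall>c\<in>pos_orthant. \<forall>e\<in>pos_orthant. subset_poly s a c e \<noteq> 0"
    by (metis sgn_zero_iff)
qed

section \<open>Injectivity of \<open>N diag(c) V diag(e)\<close> on the image of \<open>N\<close>\<close>

definition scaled_injective :: "real^'r^'n \<Rightarrow> real^'n^'r \<Rightarrow> bool" where
  "scaled_injective N V \<longleftrightarrow> (\<forall>c\<in>pos_orthant. \<forall>e\<in>pos_orthant. \<forall>u\<in>range ((*v) N).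
      N *v (c * (V *v (e * u))) = 0 \<longrightarrow> u = 0)"

lemma subspace_range_matrix_vector_mult: "subspace (range ((*v) (N::real^'c^'r)))"
  using linear_subspace_image[OF matrix_vector_mul_linear subspace_UNIV] by simp

lemma matrix_factor_through_spanning_family:
  fixes N :: "real^'r^'n"
  assumes span: "\<And>u. u \<in> range ((*v) N) \<Longrightarrow> \<exists>w. u = (\<Sum>k<s. w k *\<^sub>R b k)"
  shows "\<exists>C. \<forall>i j. N $ i $ j = (\<Sum>k<s. b k $ i * C k j)"
proof -
  define C where "C = (\<lambda>k j. (SOME w. column j N = (\<Sum>k<s. w k *\<^sub>R b k)) k)"
  have "N $ i $ j = (\<Sum>k<s. b k $ i * C k j)" for i j
  proof -
    have "column j N \<in> range ((*v) N)"
      by (metis matrix_vector_mult_basis rangeI)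
    then have "column j N = (\<Sum>k<s. C k j *\<^sub>R b k)"
      unfolding C_def by (rule someI_ex[OF span])
    then have "column j N $ i = (\<Sum>k<s. C k j * b k $ i)"
      by (simp add: sum_component)
    then show ?thesis
      by (simp add: column_def mult.commute)
  qed
  then show ?thesis by blast
qed

lemma obtain_range_basis:
  fixes N :: "real^'r^'n"
  obtains b :: "nat \<Rightarrow> real^'n" and C :: "nat \<Rightarrow> 'r \<Rightarrow> real"
  where "\<And>k. k < rank N \<Longrightarrow> b k \<in> range ((*v) N)"
    and "\<And>u. u \<in> range ((*v) N) \<Longrightarrow> \<exists>w. u = (\<Sum>k<rank N. w k *\<^sub>R b k)"
    and "\<And>w k. (\<Sum>k<rank N. w k *\<^sub>R b k) = 0 \<Longrightarrow> k < rank N \<Longrightarrow> w k = 0"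
    and "\<And>i j. N $ i $ j = (\<Sum>k<rank N. b k $ i * C k j)"
proof -
  let ?S = "range ((*v) N)"
  obtain B where B: "B \<subseteq> ?S" "independent B" "?S \<subseteq> span B" "card B = dim ?S"
    by (rule basis_exists)
  have fin: "finite B"
    using B(2) by (simp add: independent_explicit)
  define b where "b = enum_set B"
  have bij: "bij_betw b {..<rank N} B"
    unfolding b_def using enum_set_bij[OF fin] B(4) by (simp add: rank_dim_range)
  have span: "\<exists>w. u = (\<Sum>k<rank N. w k *\<^sub>R b k)" if u: "u \<in> ?S" for u
  proof -
    obtain c where "u = (\<Sum>v\<in>B. c v *\<^sub>R v)"
      using u B(3) span_finite[OF fin] by auto
    also have "\<dots> = (\<Sum>k<rank N. c (b k) *\<^sub>R b k)"
      by (rule sum.reindex_bij_betw[OF bij, symmetric])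
    finally show ?thesis
      by (intro exI[of _ "\<lambda>k. c (b k)"])
  qed
  have indep: "w k = 0" if "(\<Sum>k<rank N. w k *\<^sub>R b k) = 0" "k < rank N" for w k
  proof -
    define c where "c = (\<lambda>v. w (inv_into {..<rank N} b v))"
    have "(\<Sum>v\<in>B. c v *\<^sub>R v) = (\<Sum>k<rank N. w k *\<^sub>R b k)"
      unfolding c_def using bij
      by (subst sum.reindex_bij_betw[OF bij, symmetric]) (auto simp: bij_betw_def inv_into_f_f)
    then have "c (b k) = 0"
      using B(2) bij that unfolding independent_explicit bij_betw_def by auto
    then show ?thesis
      using bij that(2) by (simp add: c_def bij_betw_def inv_into_f_f)
  qed
  obtain C where "\<And>i j. N $ i $ j = (\<Sum>k<rank N. b k $ i * C k j)"
    using matrix_factor_through_spanning_family[OF span] by blast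
  with that[of b C] bij B(1) span indep show ?thesis
    by (auto simp: bij_betw_def)
qed

lemma matrix_vector_mult_factored:
  assumes N: "\<And>i j. N $ i $ j = (\<Sum>k<s. b k $ i * C k j)"
  shows "N *v y = (\<Sum>k<s. (\<Sum>j\<in>UNIV. C k j * y $ j) *\<^sub>R b k)"
proof (rule Finite_Cartesian_Product.vec_eq_iff[THEN iffD2, rule_format])
  fix i
  have "(N *v y) $ i = (\<Sum>j\<in>UNIV. \<Sum>k<s. b k $ i * C k j * y $ j)"
    by (simp add: matrix_vector_mult_def N sum_distrib_right)
  also have "\<dots> = (\<Sum>k<s. \<Sum>j\<in>UNIV. b k $ i * C k j * y $ j)"
    by (rule sum.swap)
  also have "\<dots> = (\<Sum>k<s. (\<Sum>j\<in>UNIV. C k j * y $ j) *\<^sub>R b k) $ i"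
    by (simp add: sum_component sum_distrib_left mult_ac)
  finally show "(N *v y) $ i = (\<Sum>k<s. (\<Sum>j\<in>UNIV. C k j * y $ j) *\<^sub>R b k) $ i" .
qed

lemma scaled_map_on_basis:
  fixes N :: "real^'r^'n" and V :: "real^'n^'r"
  assumes N: "\<And>i j. N $ i $ j = (\<Sum>k<s. b k $ i * C k j)"
  shows "N *v (c * (V *v (e * (\<Sum>l<s. w l *\<^sub>R b l)))) =
    (\<Sum>k<s. (\<Sum>l<s. (\<Sum>j\<in>UNIV. C k j * c $ j * (\<Sum>i\<in>UNIV. V $ j $ i * e $ i * b l $ i)) * w l) *\<^sub>R b k)"
proof -
  have "(V *v (e * (\<Sum>l<s. w l *\<^sub>R b l))) $ j = (\<Sum>i\<in>UNIV. \<Sum>l<s. w l * (V $ j $ i * e $ i * b l $ i))"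
    for j by (simp add: matrix_vector_mult_def sum_component sum_distrib_left mult_ac)
  also have "\<dots> j = (\<Sum>l<s. w l * (\<Sum>i\<in>UNIV. V $ j $ i * e $ i * b l $ i))" for j
    by (subst sum.swap) (simp add: sum_distrib_left)
  finally have "(\<Sum>j\<in>UNIV. C k j * (c * (V *v (e * (\<Sum>l<s. w l *\<^sub>R b l)))) $ j) =
      (\<Sum>j\<in>UNIV. \<Sum>l<s. C k j * c $ j * (\<Sum>i\<in>UNIV. V $ j $ i * e $ i * b l $ i) * w l)" for k
    by (simp add: sum_distrib_left mult_ac)
  also have "\<dots> k = (\<Sum>l<s. (\<Sum>j\<in>UNIV. C k j * c $ j * (\<Sum>i\<in>UNIV. V $ j $ i * e $ i * b l $ i)) * w l)" for k
    by (subst sum.swap) (simp add: sum_distrib_right)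
  finally show ?thesis
    by (simp add: matrix_vector_mult_factored[OF N])
qed

lemma scaled_injective_on_basis_iff:
  fixes N :: "real^'r^'n" and V :: "real^'n^'r"
  assumes b_range: "\<And>k. k < s \<Longrightarrow> b k \<in> range ((*v) N)"
    and b_span: "\<And>u. u \<in> range ((*v) N) \<Longrightarrow> \<exists>w. u = (\<Sum>k<s. w k *\<^sub>R b k)"
    and b_indep: "\<And>w k. (\<Sum>k<s. w k *\<^sub>R b k) = 0 \<Longrightarrow> k < s \<Longrightarrow> w k = 0"
    and N: "\<And>i j. N $ i $ j = (\<Sum>k<s. b k $ i * C k j)"
  shows "(\<forall>u\<in>range ((*v) N). N *v (c * (V *v (e * u))) = 0 \<longrightarrow> u = 0) \<longleftrightarrow>
    det_array s (\<lambda>k l. \<Sum>j\<in>UNIV. C k j * c $ j * (\<Sum>i\<in>UNIV. V $ j $ i * e $ i * b l $ i)) \<noteq> 0"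
proof -
  define G where "G = (\<lambda>k l. \<Sum>j\<in>UNIV. C k j * c $ j * (\<Sum>i\<in>UNIV. V $ j $ i * e $ i * b l $ i))"
  define L where "L = (\<lambda>u. N *v (c * (V *v (e * u))))"
  define B where "B = (\<lambda>w. \<Sum>l<s. w l *\<^sub>R b l)"
  have B_range: "B w \<in> range ((*v) N)" for w
    unfolding B_def using b_range
    by (intro subspace_sum subspace_scale subspace_range_matrix_vector_mult) auto
  have B_eq_0: "B w = 0 \<longleftrightarrow> (\<forall>l<s. w l = 0)" for w
    unfolding B_def using b_indep by (auto intro: sum.neutral)
  have L_B: "L (B w) = B (\<lambda>k. \<Sum>l<s. G k l * w l)" for w
    unfolding L_def B_def G_def by (rule scaled_map_on_basis[OF N])
  have "(\<forall>u\<in>range ((*v) N). L u = 0 \<longrightarrow> u = 0) \<longleftrightarrow> (\<forall>w. L (B w) = 0 \<longrightarrow> B w = 0)"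
  proof
    assume H: "\<forall>w. L (B w) = 0 \<longrightarrow> B w = 0"
    show "\<forall>u\<in>range ((*v) N). L u = 0 \<longrightarrow> u = 0"
    proof (intro ballI impI)
      fix u assume u: "u \<in> range ((*v) N)" and "L u = 0"
      moreover obtain w where "u = B w"
        using b_span[OF u] unfolding B_def by blast
      ultimately show "u = 0"
        using H by simp
    qed
  next
    assume H: "\<forall>u\<in>range ((*v) N). L u = 0 \<longrightarrow> u = 0"
    show "\<forall>w. L (B w) = 0 \<longrightarrow> B w = 0"
      using H[rule_format, OF B_range] by blast
  qed
  also have "\<dots> \<longleftrightarrow> (\<forall>w. (\<forall>k<s. (\<Sum>l<s. G k l * w l) = 0) \<longrightarrow> (\<forall>l<s. w l = 0))"
    unfolding L_B B_eq_0 ..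
  also have "\<dots> \<longleftrightarrow> det_array s G \<noteq> 0"
    by (rule det_array_nonzero_iff[symmetric])
  finally show ?thesis
    unfolding G_def L_def .
qed

lemma det_scaled_map_eq_subset_poly:
  fixes N :: "real^'r^'n" and V :: "real^'n^'r"
  assumes N: "\<And>i j. N $ i $ j = (\<Sum>k<s. b k $ i * C k j)"
  shows "det_array s (\<lambda>k l. \<Sum>j\<in>UNIV. C k j * c $ j * (\<Sum>i\<in>UNIV. V $ j $ i * e $ i * b l $ i)) =
    subset_poly s (\<lambda>I J. submat_det N I J * submat_det V J I) c e"
proof -
  define dB where "dB = (\<lambda>I. det_array s (\<lambda>t l. b l $ enum_set I t))"
  define dC where "dC = (\<lambda>J. det_array s (\<lambda>k m. C k (enum_set J m)))"
  have N_minor: "submat_det N I J = dB I * dC J" if "card I = s" for I J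
    using that det_array_mult[of s "\<lambda>m t. b t $ enum_set I m" "\<lambda>t k. C t (enum_set J k)"]
    by (simp add: submat_det_eq_det_array N dB_def dC_def)
  have C_minor: "det_array s (\<lambda>k m. C k (enum_set J m) * c $ enum_set J m) = (\<Prod>j\<in>J. c $ j) * dC J"
    if "card J = s" for J
    using det_array_scale_cols[of s "\<lambda>k m. C k (enum_set J m)"] prod_enum_set[of J "\<lambda>j. c $ j"] that
    by (simp add: dC_def)
  have V_minor: "det_array s (\<lambda>m t. V $ enum_set J m $ enum_set I t * e $ enum_set I t) =
      (\<Prod>i\<in>I. e $ i) * submat_det V J I" if "card I = s" "card J = s" for I J
    using det_array_scale_cols[of s "\<lambda>m t. V $ enum_set J m $ enum_set I t"] prod_enum_set[of I "\<lambda>i. e $ i"] that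
    by (simp add: submat_det_eq_det_array)
  have VB: "det_array s (\<lambda>m l. \<Sum>i\<in>UNIV. V $ enum_set J m $ i * e $ i * b l $ i) =
      (\<Sum>I | card I = s. (\<Prod>i\<in>I. e $ i) * submat_det V J I * dB I)" if "card J = s" for J
    using cauchy_binet[of UNIV s "\<lambda>m i. V $ enum_set J m $ i * e $ i" "\<lambda>i l. b l $ i"] that
    by (simp add: V_minor dB_def)
  have "det_array s (\<lambda>k l. \<Sum>j\<in>UNIV. C k j * c $ j * (\<Sum>i\<in>UNIV. V $ j $ i * e $ i * b l $ i)) =
      (\<Sum>J | card J = s. (\<Prod>j\<in>J. c $ j) * dC J * (\<Sum>I | card I = s. (\<Prod>i\<in>I. e $ i) * submat_det V J I * dB I))"
    using cauchy_binet[of UNIV s "\<lambda>k j. C k j * c $ j" "\<lambda>j l. \<Sum>i\<in>UNIV. V $ j $ i * e $ i * b l $ i"]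
    by (simp add: C_minor VB)
  also have "\<dots> = subset_poly s (\<lambda>I J. submat_det N I J * submat_det V J I) c e"
    unfolding subset_poly_def sum_distrib_left
    by (subst sum.swap) (intro sum.cong refl, simp add: N_minor mult_ac)
  finally show ?thesis .
qed

lemma scaled_injective_iff_sign_consistent:
  fixes N :: "real^'r^'n" and V :: "real^'n^'r"
  shows "scaled_injective N V \<longleftrightarrow> sign_consistent (rank N) (\<lambda>I J. submat_det N I J * submat_det V J I)"
proof -
  obtain b C where b_range: "\<And>k. k < rank N \<Longrightarrow> b k \<in> range ((*v) N)"
    and b_span: "\<And>u. u \<in> range ((*v) N) \<Longrightarrow> \<exists>w. u = (\<Sum>k<rank N. w k *\<^sub>R b k)"
    and b_indep: "\<And>w k. (\<Sum>k<rank N. w k *\<^sub>R b k) = 0 \<Longrightarrow> k < rank N \<Longrightarrow> w k = 0"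
    and N: "\<And>i j. N $ i $ j = (\<Sum>k<rank N. b k $ i * C k j)"
    by (rule obtain_range_basis[of N]) blast
  have "(\<forall>u\<in>range ((*v) N). N *v (c * (V *v (e * u))) = 0 \<longrightarrow> u = 0) \<longleftrightarrow>
      det_array (rank N) (\<lambda>k l. \<Sum>j\<in>UNIV. C k j * c $ j * (\<Sum>i\<in>UNIV. V $ j $ i * e $ i * b l $ i)) \<noteq> 0"
    for c e
    using b_range b_span b_indep N by (rule scaled_injective_on_basis_iff)
  then have "(\<forall>u\<in>range ((*v) N). N *v (c * (V *v (e * u))) = 0 \<longrightarrow> u = 0) \<longleftrightarrow>
      subset_poly (rank N) (\<lambda>I J. submat_det N I J * submat_det V J I) c e \<noteq> 0" for c e
    by (simp add: det_scaled_map_eq_subset_poly[OF N])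
  then show ?thesis
    unfolding scaled_injective_def by (simp add: subset_poly_nonvanishing_iff)
qed

section \<open>The Jacobian of \<open>f_kappa\<close>\<close>

lemma has_derivative_vec_lambda:
  fixes g :: "'j::finite \<Rightarrow> 'a::real_normed_vector \<Rightarrow> real"
  assumes "\<And>j. (g j has_derivative g' j) F"
  shows "((\<lambda>x. \<chi> j. g j x) has_derivative (\<lambda>h. \<chi> j. g' j h)) F"
proof -
  have eq: "(\<chi> j. f j) = (\<Sum>j\<in>UNIV. f j *\<^sub>R axis j (1::real))" for f :: "'j \<Rightarrow> real"
    by (simp add: Finite_Cartesian_Product.vec_eq_iff sum_component axis_def
        if_distrib[of "\<lambda>x. _ * x"] sum.delta cong: if_cong)
  have "((\<lambda>x. \<Sum>j\<in>UNIV. g j x *\<^sub>R axis j (1::real)) has_derivative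
      (\<lambda>h. \<Sum>j\<in>UNIV. g' j h *\<^sub>R axis j (1::real))) F"
    by (intro has_derivative_sum has_derivative_scaleR_left assms)
  then show ?thesis
    by (simp only: eq)
qed

lemma f_kappa_eq: "f_kappa N V \<kappa> x = N *v (\<kappa> * monom_vec V x)"
  by (simp add: f_kappa_def times_vec_def)

lemma has_derivative_monom_vec_component:
  assumes x: "x \<in> pos_orthant"
  shows "((\<lambda>x. monom_vec V x $ j) has_derivative
     (\<lambda>h. monom_vec V x $ j * (\<Sum>i\<in>UNIV. V $ j $ i * (h $ i / x $ i)))) (at x)"
proof -
  have "((\<lambda>x. x $ i powr V $ j $ i) has_derivative (\<lambda>h. x $ i powr V $ j $ i * (h $ i * V $ j $ i) / x $ i))
      (at x)" for i
    using pos_orthantD[OF x, of i]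
    by (auto intro!: derivative_eq_intros bounded_linear_imp_has_derivative[OF bounded_linear_vec_nth])
  then have "((\<lambda>x. \<Prod>i\<in>UNIV. x $ i powr V $ j $ i) has_derivative
      (\<lambda>h. \<Sum>i\<in>UNIV. (x $ i powr V $ j $ i * (h $ i * V $ j $ i) / x $ i) *
        (\<Prod>i'\<in>UNIV - {i}. x $ i' powr V $ j $ i'))) (at x)"
    by (rule has_derivative_prod)
  moreover have "(\<lambda>h. \<Sum>i\<in>UNIV. (x $ i powr V $ j $ i * (h $ i * V $ j $ i) / x $ i) *
        (\<Prod>i'\<in>UNIV - {i}. x $ i' powr V $ j $ i')) =
      (\<lambda>h. monom_vec V x $ j * (\<Sum>i\<in>UNIV. V $ j $ i * (h $ i / x $ i)))"
  proof
    fix h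
    have "(x $ i powr V $ j $ i * (h $ i * V $ j $ i) / x $ i) * (\<Prod>i'\<in>UNIV - {i}. x $ i' powr V $ j $ i') =
        monom_vec V x $ j * (V $ j $ i * (h $ i / x $ i))" for i
      unfolding monom_vec_def by (simp add: prod.remove[of UNIV i])
    then show "(\<Sum>i\<in>UNIV. (x $ i powr V $ j $ i * (h $ i * V $ j $ i) / x $ i) *
        (\<Prod>i'\<in>UNIV - {i}. x $ i' powr V $ j $ i')) =
      monom_vec V x $ j * (\<Sum>i\<in>UNIV. V $ j $ i * (h $ i / x $ i))"
      unfolding sum_distrib_left by (rule sum.cong[OF refl])
  qed
  ultimately show ?thesis
    unfolding monom_vec_def by simp
qed

lemma has_derivative_f_kappa:
  assumes x: "x \<in> pos_orthant"
  shows "(f_kappa N V \<kappa> has_derivative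
     (\<lambda>h. N *v ((\<kappa> * monom_vec V x) * (V *v ((\<chi> i. 1 / x $ i) * h))))) (at x)"
proof -
  have "((\<lambda>y. \<chi> j. \<kappa> $ j * monom_vec V y $ j) has_derivative
     (\<lambda>h. \<chi> j. \<kappa> $ j * (monom_vec V x $ j * (\<Sum>i\<in>UNIV. V $ j $ i * (h $ i / x $ i))))) (at x)"
    by (intro has_derivative_vec_lambda has_derivative_mult_right has_derivative_monom_vec_component[OF x])
  then have "(f_kappa N V \<kappa> has_derivative
     (\<lambda>h. N *v (\<chi> j. \<kappa> $ j * (monom_vec V x $ j * (\<Sum>i\<in>UNIV. V $ j $ i * (h $ i / x $ i)))))) (at x)"
    unfolding f_kappa_def by (rule bounded_linear.has_derivative[OF matrix_vector_mul_bounded_linear])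
  moreover have "(\<chi> j. \<kappa> $ j * (monom_vec V x $ j * (\<Sum>i\<in>UNIV. V $ j $ i * (h $ i / x $ i)))) =
      (\<kappa> * monom_vec V x) * (V *v ((\<chi> i. 1 / x $ i) * h))" for h
    by (simp add: Finite_Cartesian_Product.vec_eq_iff matrix_vector_mult_def mult_ac)
  ultimately show ?thesis
    by simp
qed

lemma jacobian_f_kappa:
  assumes "x \<in> pos_orthant"
  shows "jacobian (f_kappa N V \<kappa>) (at x) *v v = N *v ((\<kappa> * monom_vec V x) * (V *v ((\<chi> i. 1 / x $ i) * v)))"
proof -
  note D = has_derivative_f_kappa[OF assms, of N V \<kappa>]
  then have "f_kappa N V \<kappa> differentiable (at x)"
    by (rule differentiableI)
  then have "(f_kappa N V \<kappa> has_derivative (\<lambda>h. jacobian (f_kappa N V \<kappa>) (at x) *v h)) (at x)"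
    by (simp add: jacobian_works)
  from has_derivative_unique[OF this D] show ?thesis
    by (rule fun_cong)
qed

lemma jacobian_injective_iff_scaled_injective:
  fixes N :: "real^'r^'n" and V :: "real^'n^'r"
  shows "(\<forall>\<kappa>\<in>pos_orthant. \<forall>x\<in>pos_orthant.
        inj_on (\<lambda>v. jacobian (f_kappa N V \<kappa>) (at x) *v v) (range ((*v) N))) \<longleftrightarrow> scaled_injective N V"
proof -
  have "(\<forall>\<kappa>\<in>pos_orthant. \<forall>x\<in>pos_orthant.
        inj_on (\<lambda>v. jacobian (f_kappa N V \<kappa>) (at x) *v v) (range ((*v) N))) \<longleftrightarrow>
      (\<forall>\<kappa>\<in>pos_orthant. \<forall>x\<in>pos_orthant. \<forall>u\<in>range ((*v) N).
        N *v ((\<kappa> * monom_vec V x) * (V *v ((\<chi> i. 1 / x $ i) * u))) = 0 \<longrightarrow> u = 0)"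
    unfolding linear_inj_on_iff_eq_0[OF matrix_vector_mul_linear subspace_range_matrix_vector_mult]
    by (simp add: jacobian_f_kappa)
  also have "\<dots> \<longleftrightarrow> scaled_injective N V"
    unfolding scaled_injective_def
  proof (intro iffI ballI impI)
    fix c e u assume H: "\<forall>\<kappa>\<in>pos_orthant. \<forall>x\<in>pos_orthant. \<forall>u\<in>range ((*v) N).
        N *v ((\<kappa> * monom_vec V x) * (V *v ((\<chi> i. 1 / x $ i) * u))) = 0 \<longrightarrow> u = 0"
      and c: "c \<in> pos_orthant" and e: "e \<in> pos_orthant" and u: "u \<in> range ((*v) N)"
      and eq: "N *v (c * (V *v (e * u))) = 0"
    define x where "x = (\<chi> i. 1 / e $ i)"
    have x: "x \<in> pos_orthant" and e_x: "(\<chi> i. 1 / x $ i) = e"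
      using pos_orthant_inverse[OF e] by (simp_all add: x_def Finite_Cartesian_Product.vec_eq_iff)
    define \<kappa> where "\<kappa> = (\<chi> j. c $ j / monom_vec V x $ j)"
    have \<kappa>: "\<kappa> \<in> pos_orthant" "\<kappa> * monom_vec V x = c"
      unfolding \<kappa>_def using pos_orthant_divide[OF c monom_vec_pos[OF x]] by simp_all
    then have "N *v ((\<kappa> * monom_vec V x) * (V *v ((\<chi> i. 1 / x $ i) * u))) = 0"
      using eq by (simp add: e_x)
    then show "u = 0"
      using H \<kappa>(1) x u by blast
  next
    fix \<kappa> x u
    assume H: "\<forall>c\<in>pos_orthant. \<forall>e\<in>pos_orthant. \<forall>u\<in>range ((*v) N).
        N *v (c * (V *v (e * u))) = 0 \<longrightarrow> u = 0"
      and \<kappa>: "\<kappa> \<in> pos_orthant" and x: "x \<in> pos_orthant" and u: "u \<in> range ((*v) N)"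
      and "N *v ((\<kappa> * monom_vec V x) * (V *v ((\<chi> i. 1 / x $ i) * u))) = 0"
    then show "u = 0"
      using pos_orthant_mult[OF \<kappa> monom_vec_pos[OF x]] pos_orthant_inverse[OF x] by blast
  qed
  finally show ?thesis .
qed

section \<open>Sign vectors\<close>

lemma sign_vec_eq_iff: "sign_vec a = sign_vec b \<longleftrightarrow> (\<forall>i. sgn (a $ i) = sgn (b $ i))"
  by (simp add: sign_vec_def Finite_Cartesian_Product.vec_eq_iff)

lemma sign_vec_mult_pos: "c \<in> pos_orthant \<Longrightarrow> sign_vec (c * y) = sign_vec y"
  by (simp add: sign_vec_eq_iff sgn_mult pos_orthantD)

lemma sign_vec_eq_iff_pos_mult: "sign_vec b = sign_vec a \<longleftrightarrow> (\<exists>c\<in>pos_orthant. c * a = b)"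
proof
  assume s: "sign_vec b = sign_vec a"
  define c where "c = (\<chi> i. if a $ i = 0 then 1 else b $ i / a $ i)"
  have c: "c $ i > 0 \<and> c $ i * a $ i = b $ i" for i
    using s[unfolded sign_vec_eq_iff, rule_format, of i]
    by (cases "a $ i > 0"; cases "b $ i > 0") (auto simp: c_def sgn_if divide_pos_neg divide_neg_neg split: if_splits)
  then have "c \<in> pos_orthant"
    by (simp add: pos_orthant_def)
  moreover have "c * a = b"
    using c by (simp add: Finite_Cartesian_Product.vec_eq_iff)
  ultimately show "\<exists>c\<in>pos_orthant. c * a = b"
    by blast
qed (auto simp: sign_vec_mult_pos)

lemma sign_condition_iff:
  fixes N :: "real^'r^'n" and V :: "real^'n^'r"
  shows "sign_vec ` {y. N *v y = 0} \<inter> sign_vec ` ((*v) V ` Sigma_set (S - {0})) = {} \<longleftrightarrow>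
    \<not> (\<exists>y z u. N *v y = 0 \<and> u \<in> S \<and> u \<noteq> 0 \<and> sign_vec z = sign_vec u \<and> sign_vec y = sign_vec (V *v z))"
  unfolding Sigma_set_def by blast

lemma sign_condition_iff_scaled_kernel:
  fixes N :: "real^'r^'n" and V :: "real^'n^'r"
  shows "sign_vec ` {y. N *v y = 0} \<inter> sign_vec ` ((*v) V ` Sigma_set (S - {0})) = {} \<longleftrightarrow>
    (\<forall>c\<in>pos_orthant. \<forall>e\<in>pos_orthant. \<forall>u\<in>S. N *v (c * (V *v (e * u))) = 0 \<longrightarrow> u = 0)"
  unfolding sign_condition_iff sign_vec_eq_iff_pos_mult
proof (intro iffI ballI impI)
  fix c e u assume "\<not> (\<exists>y z u. N *v y = 0 \<and> u \<in> S \<and> u \<noteq> 0 \<and>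
      (\<exists>e\<in>pos_orthant. e * u = z) \<and> (\<exists>c\<in>pos_orthant. c * (V *v z) = y))"
    and "c \<in> pos_orthant" "e \<in> pos_orthant" "u \<in> S" "N *v (c * (V *v (e * u))) = 0"
  then show "u = 0"
    by (metis (no_types))
next
  assume K: "\<forall>c\<in>pos_orthant. \<forall>e\<in>pos_orthant. \<forall>u\<in>S. N *v (c * (V *v (e * u))) = 0 \<longrightarrow> u = 0"
  show "\<not> (\<exists>y z u. N *v y = 0 \<and> u \<in> S \<and> u \<noteq> 0 \<and>
      (\<exists>e\<in>pos_orthant. e * u = z) \<and> (\<exists>c\<in>pos_orthant. c * (V *v z) = y))"
  proof
    assume "\<exists>y z u. N *v y = 0 \<and> u \<in> S \<and> u \<noteq> 0 \<and>
      (\<exists>e\<in>pos_orthant. e * u = z) \<and> (\<exists>c\<in>pos_orthant. c * (V *v z) = y)"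
    then obtain u c e where "u \<in> S" "u \<noteq> 0" "c \<in> pos_orthant" "e \<in> pos_orthant"
      and "N *v (c * (V *v (e * u))) = 0"
      by blast
    with K show False
      by blast
  qed
qed

section \<open>Injectivity of \<open>f_kappa\<close> on the positive parts of cosets of \<open>S\<close>\<close>

lemma ln_diff_sgn: "0 < a \<Longrightarrow> 0 < b \<Longrightarrow> sgn (ln a - ln b) = sgn (a - b :: real)"
  by (cases a b rule: linorder_cases) auto

lemma ln_monom_vec:
  assumes "x \<in> pos_orthant"
  shows "ln (monom_vec V x $ j) = (\<Sum>i\<in>UNIV. V $ j $ i * ln (x $ i))"
  using pos_orthantD[OF assms] by (simp add: monom_vec_def ln_prod ln_powr less_imp_neq[symmetric])

lemma sign_vec_monom_vec_diff:
  assumes x: "x \<in> pos_orthant" and y: "y \<in> pos_orthant"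
  shows "sign_vec (monom_vec V x - monom_vec V y) = sign_vec (V *v (\<chi> i. ln (x $ i) - ln (y $ i)))"
  unfolding sign_vec_eq_iff
proof
  fix j
  have "(V *v (\<chi> i. ln (x $ i) - ln (y $ i))) $ j = ln (monom_vec V x $ j) - ln (monom_vec V y $ j)"
    by (simp add: ln_monom_vec[OF x] ln_monom_vec[OF y] matrix_vector_mult_def right_diff_distrib sum_subtractf)
  moreover have "sgn (ln (monom_vec V x $ j) - ln (monom_vec V y $ j)) = sgn (monom_vec V x $ j - monom_vec V y $ j)"
    by (intro ln_diff_sgn pos_orthantD monom_vec_pos x y)
  ultimately show "sgn ((monom_vec V x - monom_vec V y) $ j) = sgn ((V *v (\<chi> i. ln (x $ i) - ln (y $ i))) $ j)"
    by simp
qed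

lemma f_kappa_diff: "f_kappa N V \<kappa> x - f_kappa N V \<kappa> y = N *v (\<kappa> * (monom_vec V x - monom_vec V y))"
  by (simp add: f_kappa_eq right_diff_distrib matrix_vector_mult_diff_distrib)

lemma exists_pos_diff_ln_diff:
  fixes z u :: real
  assumes "sgn z = sgn u"
  shows "\<exists>x>0. \<exists>y>0. x - y = u \<and> ln x - ln y = z"
proof (cases "u = 0")
  case True
  with assms show ?thesis
    by (intro exI[of _ 1]) (simp add: sgn_0_0)
next
  case False
  define y where "y = u / (exp z - 1)"
  have "sgn (exp z - 1) = sgn z"
    by (cases z "0::real" rule: linorder_cases) auto
  with assms False have y: "y > 0"
    unfolding y_def by (cases "u > 0") (auto simp: sgn_if split: if_splits intro: divide_neg_neg)
  then have "exp z - 1 \<noteq> 0"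
    by (auto simp: y_def)
  have "y * exp z - y = y * (exp z - 1)"
    by (simp add: right_diff_distrib)
  also have "\<dots> = u"
    using \<open>exp z - 1 \<noteq> 0\<close> by (simp add: y_def)
  finally have "y * exp z - y = u" .
  moreover have "ln (y * exp z) - ln y = z"
    using y by (simp add: ln_mult)
  ultimately show ?thesis
    using y by (intro exI[of _ "y * exp z"] exI[of _ y]) auto
qed

lemma exists_pos_orthant_diff_ln_diff:
  assumes "sign_vec z = sign_vec u"
  shows "\<exists>x\<in>pos_orthant. \<exists>y\<in>pos_orthant. x - y = u \<and> (\<chi> i. ln (x $ i) - ln (y $ i)) = z"
proof -
  have "\<forall>i. \<exists>xy. fst xy > 0 \<and> snd xy > 0 \<and> fst xy - snd xy = u $ i \<and> ln (fst xy) - ln (snd xy) = z $ i"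
    using exists_pos_diff_ln_diff assms unfolding sign_vec_eq_iff by fastforce
  then obtain p where p: "\<And>i. fst (p i) > 0 \<and> snd (p i) > 0 \<and> fst (p i) - snd (p i) = u $ i \<and>
      ln (fst (p i)) - ln (snd (p i)) = z $ i"
    by metis
  show ?thesis
    by (rule bexI[of _ "\<chi> i. fst (p i)"], rule bexI[of _ "\<chi> i. snd (p i)"])
       (use p in \<open>auto intro: pos_orthantI simp: Finite_Cartesian_Product.vec_eq_iff\<close>)
qed

lemma inj_on_cosets_iff:
  assumes "subspace S"
  shows "(\<forall>x'\<in>P. inj_on f ((\<lambda>y. x' + y) ` S \<inter> P)) \<longleftrightarrow> (\<forall>x\<in>P. \<forall>y\<in>P. x - y \<in> S \<longrightarrow> f x = f y \<longrightarrow> x = y)"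
proof (intro iffI ballI impI)
  fix x y assume H: "\<forall>x'\<in>P. inj_on f ((\<lambda>y. x' + y) ` S \<inter> P)" and "x \<in> P" "y \<in> P" "x - y \<in> S" "f x = f y"
  moreover have "x \<in> (\<lambda>v. y + v) ` S" "y \<in> (\<lambda>v. y + v) ` S"
    using \<open>x - y \<in> S\<close> subspace_0[OF assms] by (force intro: image_eqI)+
  ultimately show "x = y"
    unfolding inj_on_def by blast
next
  fix x' assume H: "\<forall>x\<in>P. \<forall>y\<in>P. x - y \<in> S \<longrightarrow> f x = f y \<longrightarrow> x = y"
  show "inj_on f ((\<lambda>y. x' + y) ` S \<inter> P)"
  proof (rule inj_onI)
    fix p q assume "p \<in> (\<lambda>y. x' + y) ` S \<inter> P" "q \<in> (\<lambda>y. x' + y) ` S \<inter> P" "f p = f q"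
    moreover from this obtain a b where "p = x' + a" "q = x' + b" "a \<in> S" "b \<in> S"
      by blast
    moreover from this have "p - q \<in> S"
      using subspace_diff[OF assms] by simp
    ultimately show "p = q"
      using H by blast
  qed
qed

lemma f_kappa_collision_iff:
  fixes N :: "real^'r^'n" and V :: "real^'n^'r"
  shows "(\<exists>\<kappa>\<in>pos_orthant. \<exists>x\<in>pos_orthant. \<exists>y\<in>pos_orthant.
      x \<noteq> y \<and> x - y \<in> S \<and> f_kappa N V \<kappa> x = f_kappa N V \<kappa> y) \<longleftrightarrow>
    (\<exists>y z u. N *v y = 0 \<and> u \<in> S \<and> u \<noteq> 0 \<and> sign_vec z = sign_vec u \<and> sign_vec y = sign_vec (V *v z))"
proof
  assume "\<exists>\<kappa>\<in>pos_orthant. \<exists>x\<in>pos_orthant. \<exists>y\<in>pos_orthant.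
      x \<noteq> y \<and> x - y \<in> S \<and> f_kappa N V \<kappa> x = f_kappa N V \<kappa> y"
  then obtain \<kappa> x y where \<kappa>: "\<kappa> \<in> pos_orthant" and x: "x \<in> pos_orthant" and y: "y \<in> pos_orthant"
    and "x \<noteq> y" "x - y \<in> S" and eq: "N *v (\<kappa> * (monom_vec V x - monom_vec V y)) = 0"
    using f_kappa_diff[of N V] by (metis eq_iff_diff_eq_0)
  moreover have "sign_vec (\<chi> i. ln (x $ i) - ln (y $ i)) = sign_vec (x - y)"
    using ln_diff_sgn pos_orthantD[OF x] pos_orthantD[OF y] by (simp add: sign_vec_eq_iff)
  moreover have "sign_vec (\<kappa> * (monom_vec V x - monom_vec V y)) = sign_vec (V *v (\<chi> i. ln (x $ i) - ln (y $ i)))"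
    using sign_vec_mult_pos[OF \<kappa>] sign_vec_monom_vec_diff[OF x y] by simp
  ultimately show "\<exists>y z u. N *v y = 0 \<and> u \<in> S \<and> u \<noteq> 0 \<and> sign_vec z = sign_vec u \<and> sign_vec y = sign_vec (V *v z)"
    by (metis right_minus_eq)
next
  assume "\<exists>y z u. N *v y = 0 \<and> u \<in> S \<and> u \<noteq> 0 \<and> sign_vec z = sign_vec u \<and> sign_vec y = sign_vec (V *v z)"
  then obtain w z u where "N *v w = 0" "u \<in> S" "u \<noteq> 0" and zu: "sign_vec z = sign_vec u"
    and wz: "sign_vec w = sign_vec (V *v z)"
    by blast
  moreover obtain x y where x: "x \<in> pos_orthant" and y: "y \<in> pos_orthant" and "x - y = u"
    and z: "(\<chi> i. ln (x $ i) - ln (y $ i)) = z"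
    using exists_pos_orthant_diff_ln_diff[OF zu] by blast
  moreover obtain \<kappa> where "\<kappa> \<in> pos_orthant" "\<kappa> * (monom_vec V x - monom_vec V y) = w"
    using wz sign_vec_monom_vec_diff[OF x y] z sign_vec_eq_iff_pos_mult by metis
  ultimately show "\<exists>\<kappa>\<in>pos_orthant. \<exists>x\<in>pos_orthant. \<exists>y\<in>pos_orthant.
      x \<noteq> y \<and> x - y \<in> S \<and> f_kappa N V \<kappa> x = f_kappa N V \<kappa> y"
    using f_kappa_diff[of N V] by (metis eq_iff_diff_eq_0 right_minus_eq)
qed

lemma f_kappa_injective_iff_sign_condition:
  fixes N :: "real^'r^'n" and V :: "real^'n^'r"
  assumes "subspace S"
  shows "(\<forall>\<kappa>\<in>pos_orthant. \<forall>x'\<in>pos_orthant. inj_on (f_kappa N V \<kappa>) ((\<lambda>y. x' + y) ` S \<inter> pos_orthant)) \<longleftrightarrow>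
    sign_vec ` {y. N *v y = 0} \<inter> sign_vec ` ((*v) V ` Sigma_set (S - {0})) = {}"
  unfolding inj_on_cosets_iff[OF assms] sign_condition_iff f_kappa_collision_iff[symmetric]
  by blast

theorem mainTheorem16:
  fixes N :: "real^'r^'n" and V :: "real^'n^'r"
  defines "S \<equiv> range (\<lambda>y. N *v y)"
    and "s \<equiv> rank N"
  shows
   "((\<forall>\<kappa>\<in>pos_orthant. \<forall>x'\<in>pos_orthant.
        inj_on (f_kappa N V \<kappa>) ((\<lambda>y. x' + y) ` S \<inter> pos_orthant))
     \<longleftrightarrow> (\<forall>\<kappa>\<in>pos_orthant. \<forall>x\<in>pos_orthant.
        inj_on (\<lambda>v. jacobian (f_kappa N V \<kappa>) (at x) *v v) S))
  \<and> ((\<forall>\<kappa>\<in>pos_orthant. \<forall>x\<in>pos_orthant.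
        inj_on (\<lambda>v. jacobian (f_kappa N V \<kappa>) (at x) *v v) S)
     \<longleftrightarrow> ((\<forall>I J I' J'. card I = s \<and> card J = s \<and> card I' = s \<and> card J' = s \<and>
            submat_det N I J * submat_det V J I \<noteq> 0 \<and>
            submat_det N I' J' * submat_det V J' I' \<noteq> 0 \<longrightarrow>
            sgn (submat_det N I J * submat_det V J I) =
            sgn (submat_det N I' J' * submat_det V J' I'))
        \<and> (\<exists>I J. card I = s \<and> card J = s \<and> submat_det N I J * submat_det V J I \<noteq> 0)))
  \<and> ((\<forall>\<kappa>\<in>pos_orthant. \<forall>x\<in>pos_orthant.
        inj_on (\<lambda>v. jacobian (f_kappa N V \<kappa>) (at x) *v v) S)
     \<longleftrightarrow> sign_vec ` {y. N *v y = 0} \<inter>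
           sign_vec ` ((\<lambda>z. V *v z) ` Sigma_set (S - {0})) = {})"
proof -
  have jac: "(\<forall>\<kappa>\<in>pos_orthant. \<forall>x\<in>pos_orthant. inj_on (\<lambda>v. jacobian (f_kappa N V \<kappa>) (at x) *v v) S)
      \<longleftrightarrow> scaled_injective N V"
    unfolding S_def by (rule jacobian_injective_iff_scaled_injective)
  have sig: "scaled_injective N V \<longleftrightarrow>
      sign_vec ` {y. N *v y = 0} \<inter> sign_vec ` ((\<lambda>z. V *v z) ` Sigma_set (S - {0})) = {}"
    unfolding S_def scaled_injective_def sign_condition_iff_scaled_kernel ..
  have inj: "(\<forall>\<kappa>\<in>pos_orthant. \<forall>x'\<in>pos_orthant. inj_on (f_kappa N V \<kappa>) ((\<lambda>y. x' + y) ` S \<inter> pos_orthant))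
      \<longleftrightarrow> sign_vec ` {y. N *v y = 0} \<inter> sign_vec ` ((\<lambda>z. V *v z) ` Sigma_set (S - {0})) = {}"
    unfolding S_def by (rule f_kappa_injective_iff_sign_condition[OF subspace_range_matrix_vector_mult])
  have min: "scaled_injective N V \<longleftrightarrow> sign_consistent s (\<lambda>I J. submat_det N I J * submat_det V J I)"
    unfolding s_def by (rule scaled_injective_iff_sign_consistent)
  show ?thesis
    unfolding jac inj sig[symmetric] using min by (simp add: sign_consistent_def)
qed

end
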